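(* Let $(A_i,\tau_i)$, $i=1,2$, be two trivolutive algebras and let $\pi\colon A_1\to A_2$ be a trivolutive homomorphism. Let $A_i=I_i\oplus B_i$ and $\tau_i=\rho_i\circ p_i$ be the canonical decompositions of $(A_i,\tau_i)$. Then, with respect to these direct sum decompositions, $$\pi=\begin{pmatrix}\pi_{11}&0\\0&\pi_{22}\end{pmatrix},$$ where $\pi_{11}\colon I_1\to I_2$ and $\pi_{22}\colon B_1\to B_2$ are both algebra homomorphisms, and $\pi_{22}$ is involutive, i.e. $\pi_{22}\circ\rho_1=\rho_2\circ\pi_{22}$. If moreover $(A_i,\tau_i)$, $i=1,2$, are trivolutive Banach algebras and $\pi$ is continuous, then $\pi_{11}$ and $\pi_{22}$ are continuous.
   Context: An involution on a complex algebra is a conjugate-linear anti-homomorphism $\rho$ with $\rho\circ\rho=\mathrm{id}$. A trivolution on a complex algebra $A$ is a non-zero conjugate-linear anti-homomorphism $\tau\colon A\to A$ (so $\tau(xy)=\tau(y)\tau(x)$) with $\tau^3=\tau\circ\tau\circ\tau=\tau$; when $A$ is normed it is additionally assumed that $\|\tau\|=1$. The pair $(A,\tau)$ is called a trivolutive algebra (a trivolutive Banach algebra if $A$ is a Banach algebra). The canonical decompositions of a trivolutive algebra $(A,\tau)$ are $A=I\oplus B$ and $\tau=\rho\circ p$, where $p=\tau^2=\tau\circ\tau$, $B=p(A)=\tau(A)$ (a subalgebra), $I=\ker p=\ker\tau$ (a two-sided ideal), and $\rho=\tau|_B$ (an involution on $B$). A trivolutive homomorphism $\pi\colon(A_1,\tau_1)\to(A_2,\tau_2)$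 is an algebra homomorphism with $\pi(\tau_1(x))=\tau_2(\pi(x))$ for all $x\in A_1$. *)

theory Defs
  imports "HOL-Analysis.Analysis"
begin

text \<open>The libraries have no class of complex algebras. Addition and multiplication come from the
  class \<^class>\<open>ring\<close> (no unit is required), and the complex scalar multiplication is a
  parameter. Norms are parameters too, so that one statement can first treat algebras without
  a norm and then the same algebras with one.\<close>

locale complex_algebra = vector_space smul
  for smul :: "complex \<Rightarrow> 'a::ring \<Rightarrow> 'a" +
  assumes mult_scale_left: "smul c x * y = smul c (x * y)"
    and mult_scale_right: "x * smul c y = smul c (x * y)"

locale complex_banach_algebra = complex_algebra smul
  for smul :: "complex \<Rightarrow> 'a::ring \<Rightarrow> 'a" +
  fixes nrm :: "'a \<Rightarrow> real"
  assumes nrm_eq_0_iff: "nrm x = 0 \<longleftrightarrow> x = 0"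
    and nrm_triangle: "nrm (x + y) \<le> nrm x + nrm y"
    and nrm_scale: "nrm (smul c x) = cmod c * nrm x"
    and nrm_mult: "nrm (x * y) \<le> nrm x * nrm y"
    and complete: "Metric_space.mcomplete UNIV (\<lambda>x y. nrm (x - y))"

definition norm_topology :: "('a::ring \<Rightarrow> real) \<Rightarrow> 'a topology" where
  "norm_topology nrm = Metric_space.mtopology UNIV (\<lambda>x y. nrm (x - y))"

text \<open>As in \<^const>\<open>onorm\<close>, the point \<open>x = 0\<close> contributes \<open>0 / 0 = 0\<close> to the supremum.
  The supremum is meaningful only for bounded operators, hence the first conjunct.\<close>

definition has_operator_norm :: "('a::ring \<Rightarrow> real) \<Rightarrow> ('a \<Rightarrow> 'a) \<Rightarrow> real \<Rightarrow> bool" where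
  "has_operator_norm nrm f K \<longleftrightarrow>
     bdd_above (range (\<lambda>x. nrm (f x) / nrm x)) \<and> (SUP x. nrm (f x) / nrm x) = K"

definition subalgebra :: "(complex \<Rightarrow> 'a::ring \<Rightarrow> 'a) \<Rightarrow> 'a set \<Rightarrow> bool" where
  "subalgebra smul S \<longleftrightarrow> module.subspace smul S \<and> (\<forall>x\<in>S. \<forall>y\<in>S. x * y \<in> S)"

definition algebra_hom_on ::
  "(complex \<Rightarrow> 'a::ring \<Rightarrow> 'a) \<Rightarrow> (complex \<Rightarrow> 'b::ring \<Rightarrow> 'b) \<Rightarrow> 'a set \<Rightarrow> 'b set \<Rightarrow> ('a \<Rightarrow> 'b) \<Rightarrow> bool"
where
  "algebra_hom_on smul1 smul2 S T f \<longleftrightarrow>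
     subalgebra smul1 S \<and> subalgebra smul2 T \<and> f \<in> S \<rightarrow> T \<and>
     (\<forall>x\<in>S. \<forall>y\<in>S. f (x + y) = f x + f y) \<and>
     (\<forall>c. \<forall>x\<in>S. f (smul1 c x) = smul2 c (f x)) \<and>
     (\<forall>x\<in>S. \<forall>y\<in>S. f (x * y) = f x * f y)"

definition conj_antihom_on ::
  "(complex \<Rightarrow> 'a::ring \<Rightarrow> 'a) \<Rightarrow> 'a set \<Rightarrow> ('a \<Rightarrow> 'a) \<Rightarrow> bool"
where
  "conj_antihom_on smul S f \<longleftrightarrow>
     subalgebra smul S \<and> f \<in> S \<rightarrow> S \<and>
     (\<forall>x\<in>S. \<forall>y\<in>S. f (x + y) = f x + f y) \<and>
     (\<forall>c. \<forall>x\<in>S. f (smul c x) = smul (cnj c) (f x)) \<and>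
     (\<forall>x\<in>S. \<forall>y\<in>S. f (x * y) = f y * f x)"

definition involution_on ::
  "(complex \<Rightarrow> 'a::ring \<Rightarrow> 'a) \<Rightarrow> 'a set \<Rightarrow> ('a \<Rightarrow> 'a) \<Rightarrow> bool"
where
  "involution_on smul S \<rho> \<longleftrightarrow> conj_antihom_on smul S \<rho> \<and> (\<forall>x\<in>S. \<rho> (\<rho> x) = x)"

locale trivolutive_algebra = complex_algebra smul
  for smul :: "complex \<Rightarrow> 'a::ring \<Rightarrow> 'a" +
  fixes \<tau> :: "'a \<Rightarrow> 'a"
  assumes nonzero: "\<exists>x. \<tau> x \<noteq> 0"
    and conj_antihom: "conj_antihom_on smul UNIV \<tau>"
    and cube: "\<tau> \<circ> \<tau> \<circ> \<tau> = \<tau>"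

locale trivolutive_banach_algebra =
  complex_banach_algebra smul nrm + trivolutive_algebra smul \<tau>
  for smul :: "complex \<Rightarrow> 'a::ring \<Rightarrow> 'a" and nrm :: "'a \<Rightarrow> real" and \<tau> :: "'a \<Rightarrow> 'a" +
  assumes norm_trivolution: "has_operator_norm nrm \<tau> 1"

definition trivolutive_hom ::
  "(complex \<Rightarrow> 'a::ring \<Rightarrow> 'a) \<Rightarrow> ('a \<Rightarrow> 'a) \<Rightarrow> (complex \<Rightarrow> 'b::ring \<Rightarrow> 'b) \<Rightarrow> ('b \<Rightarrow> 'b) \<Rightarrow>
   ('a \<Rightarrow> 'b) \<Rightarrow> bool"
where
  "trivolutive_hom smul1 \<tau>1 smul2 \<tau>2 \<pi> \<longleftrightarrow>
     algebra_hom_on smul1 smul2 UNIV UNIV \<pi> \<and> (\<forall>x. \<pi> (\<tau>1 x) = \<tau>2 (\<pi> x))"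

definition canonical_decomposition ::
  "('a::ring \<Rightarrow> 'a) \<Rightarrow> 'a set \<Rightarrow> 'a set \<Rightarrow> ('a \<Rightarrow> 'a) \<Rightarrow> ('a \<Rightarrow> 'a) \<Rightarrow> bool"
where
  "canonical_decomposition \<tau> I B \<rho> p \<longleftrightarrow>
     p = \<tau> \<circ> \<tau> \<and> B = range p \<and> I = {x. p x = 0} \<and> \<rho> = restrict \<tau> B"

definition direct_sum_decomposition ::
  "(complex \<Rightarrow> 'a::ring \<Rightarrow> 'a) \<Rightarrow> 'a set \<Rightarrow> 'a set \<Rightarrow> bool"
where
  "direct_sum_decomposition smul U V \<longleftrightarrow>
     module.subspace smul U \<and> module.subspace smul V \<and>
     U \<inter> V = {0} \<and> (\<forall>x. \<exists>u\<in>U. \<exists>v\<in>V. x = u + v)"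

context trivolutive_algebra
begin

lemma trivolution_simps:
  "\<tau> (x + y) = \<tau> x + \<tau> y" "\<tau> (smul c x) = smul (cnj c) (\<tau> x)" "\<tau> (x * y) = \<tau> y * \<tau> x"
  "\<tau> (\<tau> (\<tau> x)) = \<tau> x" "\<tau> 0 = 0" "\<tau> (x - y) = \<tau> x - \<tau> y"
proof -
  show add: "\<tau> (x + y) = \<tau> x + \<tau> y" for x y
    using conj_antihom by (simp add: conj_antihom_on_def)
  show "\<tau> (smul c x) = smul (cnj c) (\<tau> x)" "\<tau> (x * y) = \<tau> y * \<tau> x"
    using conj_antihom by (simp_all add: conj_antihom_on_def)
  show "\<tau> (\<tau> (\<tau> x)) = \<tau> x" using cube by (metis comp_apply)
  show "\<tau> 0 = 0" using add[of 0 0] by simp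
  show "\<tau> (x - y) = \<tau> x - \<tau> y" using add[of "x - y" y] by (simp add: algebra_simps)
qed

lemma canonical_decomposition_properties:
  assumes "canonical_decomposition \<tau> I B \<rho> p"
  shows "direct_sum_decomposition smul I B"
    and "\<And>x y. x \<in> I \<Longrightarrow> x * y \<in> I" and "\<And>x y. x \<in> I \<Longrightarrow> y * x \<in> I"
    and "subalgebra smul I" and "subalgebra smul B"
    and "B = range \<tau>" and "I = {x. \<tau> x = 0}"
    and "\<tau> = \<rho> \<circ> p" and "involution_on smul B \<rho>"
proof -
  have p: "p = \<tau> \<circ> \<tau>" and "B = range p" and "I = {x. p x = 0}" and \<rho>: "\<rho> = restrict \<tau> B"
    using assms by (auto simp: canonical_decomposition_def)
  show B: "B = range \<tau>"
    unfolding \<open>B = range p\<close> p using trivolution_simps(4) by (auto simp: image_iff) metis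
  show I: "I = {x. \<tau> x = 0}"
    unfolding \<open>I = {x. p x = 0}\<close> p using trivolution_simps(4,5) by (auto, metis)
  have fixB: "\<tau> (\<tau> x) = x" if "x \<in> B" for x
    using that trivolution_simps(4) unfolding B by auto
  have subI: "subspace I"
    unfolding subspace_def I by (simp add: trivolution_simps)
  have "0 \<in> B" unfolding B using trivolution_simps(5) by (metis rangeI)
  moreover have "x + y \<in> B" "smul c x \<in> B" "x * y \<in> B" if "x \<in> B" "y \<in> B" for x y c
  proof -
    have "x + y = \<tau> (\<tau> x + \<tau> y)" "smul c x = \<tau> (smul (cnj c) (\<tau> x))" "x * y = \<tau> (\<tau> y * \<tau> x)"
      using fixB that by (simp_all add: trivolution_simps)
    then show "x + y \<in> B" "smul c x \<in> B" "x * y \<in> B" unfolding B by (metis rangeI)+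
  qed
  ultimately have subB: "subspace B" and multB: "\<forall>x\<in>B. \<forall>y\<in>B. x * y \<in> B"
    unfolding subspace_def by auto
  show "x * y \<in> I" "y * x \<in> I" if "x \<in> I" for x y
    using that by (simp_all add: I trivolution_simps)
  then show "subalgebra smul I" using subI by (simp add: subalgebra_def)
  show sB: "subalgebra smul B" using subB multB by (simp add: subalgebra_def)
  have "x \<in> I \<inter> B \<longleftrightarrow> x = 0" for x
    using fixB[of x] \<open>0 \<in> B\<close> by (auto simp: I trivolution_simps)
  then have "I \<inter> B = {0}" by blast
  moreover have "\<exists>u\<in>I. \<exists>v\<in>B. x = u + v" for x
  proof (intro bexI)
    show "x = (x - \<tau> (\<tau> x)) + \<tau> (\<tau> x)" by simp
    show "\<tau> (\<tau> x) \<in> B" by (simp add: B)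
    show "x - \<tau> (\<tau> x) \<in> I" by (simp add: I trivolution_simps)
  qed
  ultimately show "direct_sum_decomposition smul I B"
    using subI subB by (simp add: direct_sum_decomposition_def)
  show "\<tau> = \<rho> \<circ> p"
    unfolding \<rho> p by (auto simp: B fun_eq_iff trivolution_simps)
  have "\<tau> x \<in> B" for x by (simp add: B)
  then show "involution_on smul B \<rho>"
    using sB subB multB fixB
    by (auto simp: involution_on_def conj_antihom_on_def \<rho> trivolution_simps subspace_def)
qed

end

text \<open>\<open>f\<close> is given by the operator matrix with rows \<open>(f11, f12)\<close> and \<open>(f21, f22)\<close> with
  respect to \<open>U1 \<oplus> V1\<close> and \<open>U2 \<oplus> V2\<close>. Only the values of the entries on their
  domains \<open>U1\<close> and \<open>V1\<close> matter; entries that vanish at \<open>0\<close>, in particular linear ones,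
  are determined there by \<open>f\<close>.\<close>

definition has_block_matrix ::
  "(complex \<Rightarrow> 'a::ring \<Rightarrow> 'a) \<Rightarrow> 'a set \<Rightarrow> 'a set \<Rightarrow>
   (complex \<Rightarrow> 'b::ring \<Rightarrow> 'b) \<Rightarrow> 'b set \<Rightarrow> 'b set \<Rightarrow> ('a \<Rightarrow> 'b) \<Rightarrow>
   ('a \<Rightarrow> 'b) \<Rightarrow> ('a \<Rightarrow> 'b) \<Rightarrow> ('a \<Rightarrow> 'b) \<Rightarrow> ('a \<Rightarrow> 'b) \<Rightarrow> bool"
where
  "has_block_matrix smul1 U1 V1 smul2 U2 V2 f f11 f12 f21 f22 \<longleftrightarrow>
     direct_sum_decomposition smul1 U1 V1 \<and> direct_sum_decomposition smul2 U2 V2 \<and>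
     f11 \<in> U1 \<rightarrow> U2 \<and> f12 \<in> V1 \<rightarrow> U2 \<and> f21 \<in> U1 \<rightarrow> V2 \<and> f22 \<in> V1 \<rightarrow> V2 \<and>
     (\<forall>u\<in>U1. \<forall>v\<in>V1. f (u + v) = (f11 u + f12 v) + (f21 u + f22 v))"

end

theory Submission
  imports Defs
begin

text \<open>As \<open>\<tau>\<^sup>3 = \<tau>\<close>, the maps \<open>\<tau>\<close> and \<open>\<tau>\<^sup>2\<close> have the same kernel and the same range, so the canonical
  summands \<open>I\<close> and \<open>B\<close> are the kernel and the range of \<open>\<tau>\<close>. A map that intertwines two trivolutions
  and fixes \<open>0\<close> carries kernel to kernel and range to range; hence \<open>\<pi>\<close> respects the two
  decompositions (\<open>trivolutive_hom_canonical_summands\<close>). By additivity the off-diagonal entries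
  vanish, and the diagonal entries are restrictions of \<open>\<pi>\<close>, which inherit linearity,
  multiplicativity and continuity from it. Since the involutions are the restrictions of the
  trivolutions to their ranges, the intertwining relation on \<open>B1\<close> says that the second diagonal
  entry is involutive.\<close>

lemma algebra_hom_on_restrict:
  assumes "algebra_hom_on smul1 smul2 S T f"
    and "subalgebra smul1 S'" and "subalgebra smul2 T'" and "S' \<subseteq> S" and "f \<in> S' \<rightarrow> T'"
  shows "algebra_hom_on smul1 smul2 S' T' f"
  using assms unfolding algebra_hom_on_def by (meson subsetD)

lemma trivolutive_hom_zero:
  assumes "trivolutive_hom smul1 \<tau>1 smul2 \<tau>2 \<pi>"
  shows "\<pi> 0 = 0"
proof -
  have "\<pi> (0 + 0) = \<pi> 0 + \<pi> 0"
    using assms unfolding trivolutive_hom_def algebra_hom_on_def by blast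
  then show ?thesis by simp
qed

text \<open>Both inclusions are read off from \<open>\<tau>2 \<circ> \<pi> = \<pi> \<circ> \<tau>1\<close>: an element killed by \<open>\<tau>1\<close> has an image
  killed by \<open>\<tau>2\<close>, and a value of \<open>\<tau>1\<close> is mapped to a value of \<open>\<tau>2\<close>.\<close>

lemma trivolutive_hom_canonical_summands:
  assumes "trivolutive_algebra smul1 \<tau>1" and "trivolutive_algebra smul2 \<tau>2"
    and hom: "trivolutive_hom smul1 \<tau>1 smul2 \<tau>2 \<pi>"
    and "canonical_decomposition \<tau>1 I1 B1 \<rho>1 p1"
    and "canonical_decomposition \<tau>2 I2 B2 \<rho>2 p2"
  shows "\<pi> \<in> I1 \<rightarrow> I2" and "\<pi> \<in> B1 \<rightarrow> B2"
proof -
  have I: "I1 = {x. \<tau>1 x = 0}" "I2 = {x. \<tau>2 x = 0}" and B: "B1 = range \<tau>1" "B2 = range \<tau>2"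
    using trivolutive_algebra.canonical_decomposition_properties(6,7) assms by metis+
  have comm: "\<tau>2 (\<pi> x) = \<pi> (\<tau>1 x)" for x
    using hom by (simp add: trivolutive_hom_def)
  show "\<pi> \<in> I1 \<rightarrow> I2"
    using trivolutive_hom_zero[OF hom] by (auto simp: I comm)
  show "\<pi> \<in> B1 \<rightarrow> B2"
    by (auto simp: B simp flip: comm)
qed

lemma continuous_map_between_subtopologies:
  assumes "continuous_map X Y f" and "f \<in> S \<rightarrow> T"
  shows "continuous_map (subtopology X S) (subtopology Y T) f"
  using assms by (auto simp: continuous_map_in_subtopology intro: continuous_map_from_subtopology)

theorem theorem2p5:
  fixes smul1 :: "complex \<Rightarrow> 'a::ring \<Rightarrow> 'a" and smul2 :: "complex \<Rightarrow> 'b::ring \<Rightarrow> 'b"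
    and \<tau>1 \<rho>1 p1 :: "'a \<Rightarrow> 'a" and \<tau>2 \<rho>2 p2 :: "'b \<Rightarrow> 'b"
    and I1 B1 :: "'a set" and I2 B2 :: "'b set"
    and \<pi> :: "'a \<Rightarrow> 'b"
  assumes "trivolutive_algebra smul1 \<tau>1" and "trivolutive_algebra smul2 \<tau>2"
    and "trivolutive_hom smul1 \<tau>1 smul2 \<tau>2 \<pi>"
    and "canonical_decomposition \<tau>1 I1 B1 \<rho>1 p1"
    and "canonical_decomposition \<tau>2 I2 B2 \<rho>2 p2"
  shows "\<exists>\<pi>11 \<pi>22.
    has_block_matrix smul1 I1 B1 smul2 I2 B2 \<pi> \<pi>11 (\<lambda>_. 0) (\<lambda>_. 0) \<pi>22 \<and>
    algebra_hom_on smul1 smul2 I1 I2 \<pi>11 \<and>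
    algebra_hom_on smul1 smul2 B1 B2 \<pi>22 \<and>
    (\<forall>b\<in>B1. \<pi>22 (\<rho>1 b) = \<rho>2 (\<pi>22 b)) \<and>
    (\<forall>nrm1 nrm2.
      trivolutive_banach_algebra smul1 nrm1 \<tau>1 \<and>
      trivolutive_banach_algebra smul2 nrm2 \<tau>2 \<and>
      continuous_map (norm_topology nrm1) (norm_topology nrm2) \<pi> \<longrightarrow>
      continuous_map (subtopology (norm_topology nrm1) I1) (subtopology (norm_topology nrm2) I2) \<pi>11 \<and>
      continuous_map (subtopology (norm_topology nrm1) B1) (subtopology (norm_topology nrm2) B2) \<pi>22)"
  \<comment> \<open>Both witnesses are \<open>\<pi>\<close> itself: only their values on \<open>I1\<close> and on \<open>B1\<close> matter.\<close>
proof (intro exI conjI allI impI ballI)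
  note dec1 = trivolutive_algebra.canonical_decomposition_properties[OF assms(1,4)]
  note dec2 = trivolutive_algebra.canonical_decomposition_properties[OF assms(2,5)]
  note summands = trivolutive_hom_canonical_summands[OF assms]
  have hom: "algebra_hom_on smul1 smul2 UNIV UNIV \<pi>" and comm: "\<pi> (\<tau>1 x) = \<tau>2 (\<pi> x)" for x
    using assms(3) by (simp_all add: trivolutive_hom_def)
  have add: "\<pi> (x + y) = \<pi> x + \<pi> y" for x y
    using hom by (simp add: algebra_hom_on_def)
  have "0 \<in> I2" "0 \<in> B2"
    using dec2(1) by (auto simp: direct_sum_decomposition_def)
  then show "has_block_matrix smul1 I1 B1 smul2 I2 B2 \<pi> \<pi> (\<lambda>_. 0) (\<lambda>_. 0) \<pi>"
    using dec1(1) dec2(1) summands by (simp add: has_block_matrix_def add)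
  show "algebra_hom_on smul1 smul2 I1 I2 \<pi>"
    using algebra_hom_on_restrict[OF hom dec1(4) dec2(4)] summands by simp
  show "algebra_hom_on smul1 smul2 B1 B2 \<pi>"
    using algebra_hom_on_restrict[OF hom dec1(5) dec2(5)] summands by simp
  show "\<pi> (\<rho>1 b) = \<rho>2 (\<pi> b)" if "b \<in> B1" for b
  proof -
    have "\<rho>1 = restrict \<tau>1 B1" "\<rho>2 = restrict \<tau>2 B2"
      using assms(4,5) by (simp_all add: canonical_decomposition_def)
    moreover have "\<pi> b \<in> B2"
      using summands(2) that by blast
    ultimately show ?thesis
      using that by (simp add: comm)
  qed
  fix nrm1 nrm2
  assume "trivolutive_banach_algebra smul1 nrm1 \<tau>1 \<and> trivolutive_banach_algebra smul2 nrm2 \<tau>2 \<and>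
    continuous_map (norm_topology nrm1) (norm_topology nrm2) \<pi>"
  then have cont: "continuous_map (norm_topology nrm1) (norm_topology nrm2) \<pi>"
    by simp
  show "continuous_map (subtopology (norm_topology nrm1) I1) (subtopology (norm_topology nrm2) I2) \<pi>"
    "continuous_map (subtopology (norm_topology nrm1) B1) (subtopology (norm_topology nrm2) B2) \<pi>"
    using continuous_map_between_subtopologies[OF cont] summands by blast+
qed

end
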